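(* Let $G$ be a finite multigraph (loops and multiple edges allowed) with vertices labeled $v_1,v_2,\ldots,v_d$ in a fixed order, and let $$Y_G=\sum_{\pi\in\Pi_d} c_\pi e_\pi$$ be the expansion of the noncommutative chromatic symmetric function $Y_G$ in the noncommutative elementary symmetric functions. Then for any fixed vertex $v_0$ of $G$, $$|\mathcal{A}(G,v_0)|=(d-1)!\,c_{[d]}.$$
   Context: An orientation of $G$ is a digraph formed by replacing each edge by one of the two possible directed arcs; it is acyclic if it has no directed cycles (so a graph with a loop has no acyclic orientations). A sink is a vertex such that all arcs incident with it are directed towards it. $\mathcal{A}(G,v_0)$ is the set of acyclic orientations of $G$ with a unique sink, that sink being $v_0$. $\Pi_d$ is the lattice of set partitions of $\{1,\ldots,d\}$ ordered by refinement, with meet $\wedge$ and least element $\hat 0$ (all blocks singletons). The subscript $[d]$ in $c_{[d]}$ denotes the partition of $\{1,\ldots,d\}$ with the single block $\{1,\ldots,d\}$. Let $\mathbf{x}=\{x_1,x_2,x_3,\ldots\}$ be noncommuting variables and $\mathbb{P}$ the set of positive integers. For $\pi\in\Pi_d$, $$m_\pi=\sum_{i_1,\ldots,i_d}x_{i_1}x_{i_2}\cdots x_{i_d},$$ summed over all sequences $i_1,\ldots,i_d$ in $\mathbb{P}$ with $i_j=i_k$ if and only if $j,k$ are in the same block of $\pi$. The noncommutative elementary symmetric function is $$e_\pi=\sum_{\sigma\in\Pi_d:\ \sigma\wedge\pi=\hat 0}m_\sigma=\sum_{i_1,\ldots,i_d}x_{i_1}x_{i_2}\cdots x_{i_d},$$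 the second sum being over all sequences in $\mathbb{P}$ with $i_j\neq i_k$ whenever $j\ne k$ are in the same block of $\pi$. The $m_\pi$, $\pi\in\Pi_d$, are linearly independent over $\mathbb{C}$, and $\{e_\pi:\pi\in\Pi_d\}$ is another basis of their span, so the coefficients $c_\pi$ are uniquely determined. A proper coloring $\kappa:V(G)\to\mathbb{P}$ is a map with $\kappa(u)\ne\kappa(v)$ for every edge $uv$ (so none exists if $G$ has a loop), and $$Y_G=\sum_{\kappa}x_{\kappa(v_1)}x_{\kappa(v_2)}\cdots x_{\kappa(v_d)},$$ summed over all proper colorings $\kappa:V(G)\to\mathbb{P}$. *)

theory Defs
  imports
    Complex_Main
    "HOL-Library.Disjoint_Sets"
    "HOL-Library.FuncSet"
    "HOL-Library.Uprod"
    "Graph_Theory.Arc_Walk"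
begin

section \<open>Multigraphs and their orientations\<close>

text \<open>
  Edges are named, so parallel edges are distinct edges with the same unordered pair of ends;
  a loop at \<open>u\<close> has ends \<open>Upair u u\<close>.
\<close>

record ('v, 'e) multigraph =
  nodes :: "'v set"
  edges :: "'e set"
  ends :: "'e \<Rightarrow> 'v uprod"

definition finite_multigraph :: "('v, 'e) multigraph \<Rightarrow> bool" where
  "finite_multigraph G \<longleftrightarrow> finite (nodes G) \<and> finite (edges G) \<and>
     (\<forall>a\<in>edges G. set_uprod (ends G a) \<subseteq> nodes G)"

text \<open>
  The end functions of the digraph are required to be extensional on the edge set, so that each
  orientation is counted exactly once. A loop gives rise to one arc only; this is immaterial for
  acyclic orientations.
\<close>

definition orientations :: "('v, 'e) multigraph \<Rightarrow> ('v, 'e) pre_digraph set" where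
  "orientations G = {D. verts D = nodes G \<and> arcs D = edges G \<and>
     tail D \<in> extensional (edges G) \<and> head D \<in> extensional (edges G) \<and>
     (\<forall>a\<in>edges G. Upair (tail D a) (head D a) = ends G a)}"

text \<open>With \<^const>\<open>pre_digraph.cycle\<close>, a loop is a cycle of length one.\<close>

definition acyclic_digraph :: "('v, 'e) pre_digraph \<Rightarrow> bool" where
  "acyclic_digraph D \<longleftrightarrow> \<not> (\<exists>p. pre_digraph.cycle D p)"

definition is_sink :: "('v, 'e) pre_digraph \<Rightarrow> 'v \<Rightarrow> bool" where
  "is_sink D u \<longleftrightarrow> u \<in> verts D \<and>
     (\<forall>a\<in>arcs D. tail D a = u \<or> head D a = u \<longrightarrow> head D a = u)"

definition acyclic_orientations_sink ::
    "('v, 'e) multigraph \<Rightarrow> 'v \<Rightarrow> ('v, 'e) pre_digraph set" where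
  "acyclic_orientations_sink G v0 =
     {D \<in> orientations G. acyclic_digraph D \<and> {u. is_sink D u} = {v0}}"


section \<open>Symmetric functions in noncommuting variables\<close>

text \<open>
  The monomial \<open>x\<^bsub>i1\<^esub> x\<^bsub>i2\<^esub> \<dots> x\<^bsub>id\<^esub>\<close> is the word \<open>[i1, i2, \<dots>, id]\<close>, and a formal power series is
  the function giving the coefficient of each word; linear combinations are formed pointwise.
\<close>

type_synonym nc_series = "nat list \<Rightarrow> complex"

text \<open>
  The formal sum, over all \<open>s \<in> S\<close>, of the monomials \<open>word s\<close>. It is meaningful only if each word
  arises from finitely many \<open>s\<close>, which is the case in all uses below.
\<close>

definition monomial_sum :: "'s set \<Rightarrow> ('s \<Rightarrow> nat list) \<Rightarrow> nc_series" where
  "monomial_sum S word = (\<lambda>w. of_nat (card {s \<in> S. word s = w}))"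

definition set_partitions :: "nat \<Rightarrow> nat set set set" where
  "set_partitions d = {P. partition_on {1..d} P}"

definition partition_meet :: "nat set set \<Rightarrow> nat set set \<Rightarrow> nat set set" where
  "partition_meet \<sigma> \<pi> = common_refinement {\<sigma>, \<pi>}"

definition partition_bot :: "nat \<Rightarrow> nat set set" where
  "partition_bot d = (\<lambda>j. {j}) ` {1..d}"

definition nc_m :: "nat \<Rightarrow> nat set set \<Rightarrow> nc_series" where
  "nc_m d \<pi> = monomial_sum
     {i \<in> {1..d} \<rightarrow>\<^sub>E {1..}. \<forall>j\<in>{1..d}. \<forall>k\<in>{1..d}. i j = i k \<longleftrightarrow> (\<exists>B\<in>\<pi>. j \<in> B \<and> k \<in> B)}
     (\<lambda>i. map i [1..<Suc d])"

definition nc_e :: "nat \<Rightarrow> nat set set \<Rightarrow> nc_series" where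
  "nc_e d \<pi> = (\<lambda>w. \<Sum>\<sigma> | \<sigma> \<in> set_partitions d \<and> partition_meet \<sigma> \<pi> = partition_bot d. nc_m d \<sigma> w)"

definition proper_colorings :: "('v, 'e) multigraph \<Rightarrow> ('v \<Rightarrow> nat) set" where
  "proper_colorings G = {\<kappa> \<in> nodes G \<rightarrow>\<^sub>E {1..}.
     \<forall>a\<in>edges G. \<forall>u w. ends G a = Upair u w \<longrightarrow> \<kappa> u \<noteq> \<kappa> w}"

text \<open>The vertex labelled \<open>j\<close> is \<open>v j\<close>, for \<open>1 \<le> j \<le> d\<close>.\<close>

definition nc_chromatic :: "('v, 'e) multigraph \<Rightarrow> nat \<Rightarrow> (nat \<Rightarrow> 'v) \<Rightarrow> nc_series" where
  "nc_chromatic G d v = monomial_sum (proper_colorings G) (\<lambda>\<kappa>. map (\<lambda>j. \<kappa> (v j)) [1..<Suc d])"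

end

theory Submission
  imports Defs "HOL-Computational_Algebra.Polynomial"
begin

text \<open>
  The noncommutative expansion is turned into an identity of polynomials by setting
  \<open>x\<^sub>1 = \<dots> = x\<^sub>n = 1\<close> and all other variables to \<open>0\<close>, that is, by adding up the coefficients of
  all words of length \<open>d\<close> in the letters \<open>1, \<dots>, n\<close>. The chromatic series then becomes the number of
  proper colorings with \<open>n\<close> colors, the value at \<open>n\<close> of the chromatic polynomial
  (\<open>sum_words_nc_chromatic\<close>). The series \<open>e\<^sub>\<pi>\<close> becomes the number of maps to \<open>{1..n}\<close> that are
  injective on each block, which is the product over the blocks \<open>B\<close> of the falling factorials
  \<open>n (n - 1) \<dots> (n - |B| + 1)\<close> (\<open>sum_words_nc_e\<close>). Both sides are polynomials in \<open>n\<close>, so their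
  linear coefficients agree.

  Every falling factorial of positive length is divisible by \<open>n\<close>. Hence a partition with at least
  two blocks contributes nothing to the linear coefficient, and the one-block partition contributes
  \<open>(-1)\<^sup>d\<^sup>-\<^sup>1 (d - 1)!\<close> times its coefficient in the expansion (\<open>coeff_prod_falling_poly_partition\<close>).

  It remains to use the theorem of Greene and Zaslavsky: the linear coefficient of the chromatic
  polynomial is \<open>(-1)\<^sup>d\<^sup>-\<^sup>1\<close> times the number of acyclic orientations whose only sink is \<open>v0\<close>
  (\<open>chromatic_polynomial_linear_coeff\<close>). It is proved by deletion and contraction of an edge at
  \<open>v0\<close>. Neither side of this theorem sees edge multiplicities, because parallel edges must point the
  same way in an acyclic orientation; so it is stated for symmetric relations, and
  \<open>bij_betw_arcs_ends\<close> carries it over to multigraphs.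
\<close>

section \<open>Deletion and contraction\<close>

definition relation_colorings :: "'v set \<Rightarrow> 'v rel \<Rightarrow> nat \<Rightarrow> ('v \<Rightarrow> nat) set" where
  "relation_colorings V E n = {\<kappa> \<in> V \<rightarrow>\<^sub>E {1..n}. \<forall>(x, y)\<in>E. \<kappa> x \<noteq> \<kappa> y}"

text \<open>
  A symmetric relation \<open>E\<close> stands for a simple graph with possible loops. Choosing \<open>R\<close> with
  \<open>R \<union> R\<inverse> = E\<close> could keep both directions of an edge, but acyclicity excludes that, so \<open>R\<close> is an
  orientation. The points of \<open>V\<close> outside \<open>Domain R\<close> are its sinks.
\<close>

definition acyclic_relations_sink :: "'v set \<Rightarrow> 'v rel \<Rightarrow> 'v \<Rightarrow> 'v rel set" where
  "acyclic_relations_sink V E v0 = {R. R \<union> R\<inverse> = E \<and> acyclic R \<and> V - Domain R = {v0}}"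

text \<open>
  The point \<open>u\<close> is merged into \<open>v0\<close>. The contracted edge itself is removed first, since it would
  become a loop.
\<close>

definition contraction :: "'v \<Rightarrow> 'v \<Rightarrow> 'v rel \<Rightarrow> 'v rel" where
  "contraction v0 u E = map_prod (id(u := v0)) (id(u := v0)) ` (E - {(u, v0), (v0, u)})"

lemma card_filter_split:
  assumes "finite A"
  shows "card A = card {x \<in> A. P x} + card {x \<in> A. \<not> P x}"
proof -
  have "A = {x \<in> A. P x} \<union> {x \<in> A. \<not> P x}" by auto
  moreover have "card ({x \<in> A. P x} \<union> {x \<in> A. \<not> P x}) =
      card {x \<in> A. P x} + card {x \<in> A. \<not> P x}"
    using assms by (intro card_Un_disjoint) auto
  ultimately show ?thesis by simp
qed

lemma finite_relation_colorings:
  assumes "finite V"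
  shows "finite (relation_colorings V E n)"
  unfolding relation_colorings_def using assms by (simp add: finite_PiE)

lemma finite_acyclic_relations_sink:
  assumes "finite E"
  shows "finite (acyclic_relations_sink V E v0)"
  by (rule finite_subset[of _ "Pow E"]) (use assms in \<open>auto simp: acyclic_relations_sink_def\<close>)

text \<open>
  Colorings of the graph with the edge deleted either give \<open>u\<close> and \<open>v0\<close> different colors, and are
  then proper for the whole graph, or the same color, and then they descend to the contraction.
\<close>

lemma card_relation_colorings_deletion_contraction:
  assumes "finite V" "v0 \<in> V" "u \<in> V" "u \<noteq> v0" "E \<subseteq> V \<times> V" "(u, v0) \<in> E"
  shows "card (relation_colorings V (E - {(u, v0), (v0, u)}) n) =
    card (relation_colorings V E n) + card (relation_colorings (V - {u}) (contraction v0 u E) n)"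
proof -
  let ?E1 = "E - {(u, v0), (v0, u)}"
  define h where "h = id(u := v0)"
  have h: "h x = (if x = u then v0 else x)" for x by (simp add: h_def)
  have contraction: "contraction v0 u E = map_prod h h ` ?E1"
    by (simp add: contraction_def h_def)
  let ?N = "{\<kappa> \<in> relation_colorings V ?E1 n. \<kappa> u \<noteq> \<kappa> v0}"
  let ?Q = "{\<kappa> \<in> relation_colorings V ?E1 n. \<kappa> u = \<kappa> v0}"
  have fin: "finite (relation_colorings V ?E1 n)"
    using assms(1) by (rule finite_relation_colorings)
  have split: "card (relation_colorings V ?E1 n) = card ?N + card ?Q"
    using card_filter_split[OF fin, of "\<lambda>\<kappa>. \<kappa> u \<noteq> \<kappa> v0"] by simp
  have proper: "?N = relation_colorings V E n"
    using assms(6) unfolding relation_colorings_def by fastforce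
  have contract: "bij_betw (\<lambda>\<kappa>. restrict \<kappa> (V - {u})) ?Q
      (relation_colorings (V - {u}) (contraction v0 u E) n)"
  proof (rule bij_betw_byWitness[where f' = "\<lambda>\<kappa>. \<kappa>(u := \<kappa> v0)"])
    show "\<forall>\<kappa>\<in>?Q. (restrict \<kappa> (V - {u}))(u := restrict \<kappa> (V - {u}) v0) = \<kappa>"
      using assms(2-4) by (auto simp: relation_colorings_def fun_eq_iff PiE_def extensional_def)
    show "\<forall>\<kappa>\<in>relation_colorings (V - {u}) (contraction v0 u E) n.
        restrict (\<kappa>(u := \<kappa> v0)) (V - {u}) = \<kappa>"
      by (auto simp: relation_colorings_def fun_eq_iff PiE_def extensional_def)
    show "(\<lambda>\<kappa>. restrict \<kappa> (V - {u})) ` ?Q \<subseteq>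
        relation_colorings (V - {u}) (contraction v0 u E) n"
    proof clarify
      fix \<kappa> assume \<kappa>: "\<kappa> \<in> relation_colorings V ?E1 n" "\<kappa> u = \<kappa> v0"
      let ?\<kappa> = "restrict \<kappa> (V - {u})"
      have val: "?\<kappa> (h x) = \<kappa> x" if "x \<in> V" for x
        using that assms(2,4) \<kappa>(2) by (simp add: h)
      have "?\<kappa> (h x) \<noteq> ?\<kappa> (h y)" if "(x, y) \<in> ?E1" for x y
      proof -
        have "x \<in> V" "y \<in> V" using that assms(5) by blast+
        moreover have "\<kappa> x \<noteq> \<kappa> y" using that \<kappa>(1) unfolding relation_colorings_def by blast
        ultimately show ?thesis using val by metis
      qed
      then have "?\<kappa> a \<noteq> ?\<kappa> b" if "(a, b) \<in> contraction v0 u E" for a b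
        using that unfolding contraction by (metis Pair_inject prod_fun_imageE)
      moreover have "?\<kappa> \<in> (V - {u}) \<rightarrow>\<^sub>E {1..n}"
        using \<kappa>(1) by (auto simp: relation_colorings_def PiE_iff)
      ultimately show "?\<kappa> \<in> relation_colorings (V - {u}) (contraction v0 u E) n"
        by (auto simp: relation_colorings_def simp del: restrict_apply)
    qed
    show "(\<lambda>\<kappa>. \<kappa>(u := \<kappa> v0)) ` relation_colorings (V - {u}) (contraction v0 u E) n \<subseteq> ?Q"
    proof clarify
      fix \<kappa> assume \<kappa>: "\<kappa> \<in> relation_colorings (V - {u}) (contraction v0 u E) n"
      let ?\<kappa> = "\<kappa>(u := \<kappa> v0)"
      have "\<kappa> (h x) \<noteq> \<kappa> (h y)" if "(x, y) \<in> ?E1" for x y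
      proof -
        have "(h x, h y) \<in> contraction v0 u E"
          using that unfolding contraction by (metis map_prod_imageI)
        then show ?thesis using \<kappa> unfolding relation_colorings_def by blast
      qed
      moreover have "?\<kappa> x = \<kappa> (h x)" for x by (simp add: h)
      ultimately have "\<forall>(x, y)\<in>?E1. ?\<kappa> x \<noteq> ?\<kappa> y" by auto
      moreover have "?\<kappa> \<in> V \<rightarrow>\<^sub>E {1..n}"
        using \<kappa> assms(2-4) by (auto simp: relation_colorings_def PiE_iff extensional_def)
      ultimately show "?\<kappa> \<in> relation_colorings V ?E1 n \<and> ?\<kappa> u = ?\<kappa> v0"
        using assms(4) by (simp add: relation_colorings_def)
    qed
  qed
  show ?thesis
    unfolding split bij_betw_same_card[OF contract] by (simp only: proper)
qed

text \<open>
  As \<open>v0\<close> is a sink, the edge is always directed from \<open>u\<close> to \<open>v0\<close>. If \<open>u\<close> has another outgoing arc,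
  deleting the edge creates no new sink; conversely, adding an arc into the sink \<open>v0\<close> closes no
  cycle. If the arc to \<open>v0\<close> is the only one leaving \<open>u\<close>, all other arcs at \<open>u\<close> or \<open>v0\<close> enter these two
  points, so they can be merged into a single sink. In the other direction, an orientation of the
  contraction lifts uniquely, since every edge other than the contracted one inherits the direction
  of its image.
\<close>

lemma card_acyclic_relations_sink_deletion_contraction:
  assumes "finite E" "sym E" "v0 \<in> V" "u \<in> V" "u \<noteq> v0" "(u, v0) \<in> E"
  shows "card (acyclic_relations_sink V E v0) =
    card (acyclic_relations_sink V (E - {(u, v0), (v0, u)}) v0) +
    card (acyclic_relations_sink (V - {u}) (contraction v0 u E) v0)"
proof -
  let ?E1 = "E - {(u, v0), (v0, u)}"
  define h where "h = id(u := v0)"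
  have h: "h x = (if x = u then v0 else x)" for x by (simp add: h_def)
  have contraction: "contraction v0 u E = map_prod h h ` ?E1"
    by (simp add: contraction_def h_def)
  let ?A = "acyclic_relations_sink V E v0"
  let ?N = "{R \<in> ?A. R `` {u} \<noteq> {v0}}"
  let ?T = "{R \<in> ?A. R `` {u} = {v0}}"
  have finA: "finite ?A" using assms(1) by (rule finite_acyclic_relations_sink)
  have uv0: "(u, v0) \<in> R" "(v0, x) \<notin> R" if "R \<in> ?A" for R x
    using that assms(6) by (auto simp: acyclic_relations_sink_def)
  have split: "card ?A = card ?N + card ?T"
    using card_filter_split[OF finA, of "\<lambda>R. R `` {u} \<noteq> {v0}"] by simp
  have delete: "bij_betw (\<lambda>R. R - {(u, v0)}) ?N (acyclic_relations_sink V ?E1 v0)"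
  proof (rule bij_betw_byWitness[where f' = "insert (u, v0)"])
    show "\<forall>R\<in>?N. insert (u, v0) (R - {(u, v0)}) = R"
      using uv0(1) by blast
    show "\<forall>R\<in>acyclic_relations_sink V ?E1 v0. insert (u, v0) R - {(u, v0)} = R"
      by (auto simp: acyclic_relations_sink_def)
    show "(\<lambda>R. R - {(u, v0)}) ` ?N \<subseteq> acyclic_relations_sink V ?E1 v0"
    proof clarify
      fix R assume R: "R \<in> ?A" "R `` {u} \<noteq> {v0}"
      obtain w where w: "(u, w) \<in> R" "w \<noteq> v0" using R uv0(1)[OF R(1)] by auto
      have "(R - {(u, v0)}) \<union> (R - {(u, v0)})\<inverse> = ?E1"
        using R(1) uv0[OF R(1)] by (auto simp: acyclic_relations_sink_def)
      moreover have "acyclic (R - {(u, v0)})"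
        using R(1) by (auto simp: acyclic_relations_sink_def intro: acyclic_subset)
      moreover have "Domain (R - {(u, v0)}) = Domain R" using w by auto
      ultimately show "R - {(u, v0)} \<in> acyclic_relations_sink V ?E1 v0"
        using R(1) by (simp add: acyclic_relations_sink_def)
    qed
    show "insert (u, v0) ` acyclic_relations_sink V ?E1 v0 \<subseteq> ?N"
    proof clarify
      fix R assume R: "R \<in> acyclic_relations_sink V ?E1 v0"
      then have R1: "R \<union> R\<inverse> = ?E1" "acyclic R" "V - Domain R = {v0}"
        by (auto simp: acyclic_relations_sink_def)
      have "u \<in> Domain R" using R1(3) assms(4,5) by blast
      then obtain w where w: "(u, w) \<in> R" "w \<noteq> v0" using R1(1) by blast
      \<comment> \<open>such a path would have to leave the sink \<open>v0\<close>\<close>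
      have "(v0, u) \<notin> R\<^sup>*"
        using R1(3) assms(5) by (metis Diff_iff DomainI converse_rtranclE insertI1)
      then have "acyclic (insert (u, v0) R)" using R1(2) by (simp add: acyclic_insert)
      moreover have "insert (u, v0) R \<union> (insert (u, v0) R)\<inverse> = E"
        using R1(1) assms(2,6) by (auto dest: symD)
      moreover have "V - Domain (insert (u, v0) R) = {v0}"
        using R1(3) assms(5) by auto
      ultimately show "insert (u, v0) R \<in> ?A \<and> insert (u, v0) R `` {u} \<noteq> {v0}"
        using w by (auto simp: acyclic_relations_sink_def)
    qed
  qed
  have contract: "bij_betw (\<lambda>S. insert (u, v0) {(x, y) \<in> ?E1. (h x, h y) \<in> S})
      (acyclic_relations_sink (V - {u}) (contraction v0 u E) v0) ?T"
  proof (rule bij_betw_byWitness[where f' = "\<lambda>R. map_prod h h ` (R - {(u, v0)})"])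
    show "\<forall>S\<in>acyclic_relations_sink (V - {u}) (contraction v0 u E) v0.
      map_prod h h ` (insert (u, v0) {(x, y) \<in> ?E1. (h x, h y) \<in> S} - {(u, v0)}) = S"
    proof
      fix S assume "S \<in> acyclic_relations_sink (V - {u}) (contraction v0 u E) v0"
      then have "S \<subseteq> map_prod h h ` ?E1"
        by (auto simp: acyclic_relations_sink_def contraction)
      moreover have "g ` {e \<in> A. g e \<in> S} = S" if "S \<subseteq> g ` A"
        for A and g :: "'a \<times> 'a \<Rightarrow> 'a \<times> 'a" using that by auto
      ultimately have "map_prod h h ` {e \<in> ?E1. map_prod h h e \<in> S} = S" by blast
      moreover have "{e \<in> ?E1. map_prod h h e \<in> S} =
        insert (u, v0) {(x, y) \<in> ?E1. (h x, h y) \<in> S} - {(u, v0)}" by auto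
      ultimately show "map_prod h h `
        (insert (u, v0) {(x, y) \<in> ?E1. (h x, h y) \<in> S} - {(u, v0)}) = S" by simp
    qed
    show "\<forall>R\<in>?T. insert (u, v0) {(x, y) \<in> ?E1. (h x, h y) \<in> map_prod h h ` (R - {(u, v0)})} = R"
    proof
      fix R assume R: "R \<in> ?T"
      then have E: "R \<union> R\<inverse> = E" and "R `` {u} = {v0}"
        by (auto simp: acyclic_relations_sink_def)
      with R have out: "x \<noteq> u \<and> x \<noteq> v0" if "(x, y) \<in> R - {(u, v0)}" for x y
        using that uv0(2) by blast
      \<comment> \<open>no arc other than \<open>(u, v0)\<close> starts at \<open>u\<close> or \<open>v0\<close>; so if the edge were directed from \<open>y\<close> to
        \<open>x\<close>, neither \<open>x'\<close> nor \<open>y\<close> would be merged, and both edges would coincide\<close>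
      have "(x, y) \<in> R" if xy: "(x, y) \<in> ?E1" "(h x, h y) = (h x', h y')"
        and "(x', y') \<in> R - {(u, v0)}" for x y x' y'
      proof (rule ccontr)
        assume "(x, y) \<notin> R"
        then have "(y, x) \<in> R - {(u, v0)}" using xy(1) E by blast
        then have "y \<noteq> u" "y \<noteq> v0" "x' \<noteq> u" "x' \<noteq> v0" using out that(3) by blast+
        then have "x = x'" "y = y'" using xy(2) by (auto simp: h split: if_splits)
        then show False using \<open>(x, y) \<notin> R\<close> that(3) by blast
      qed
      then have E1_R: "(x, y) \<in> R"
        if "(x, y) \<in> ?E1" "(h x, h y) \<in> map_prod h h ` (R - {(u, v0)})" for x y
        using that by (metis prod_fun_imageE)
      have R_E1: "(x, y) \<in> ?E1 \<and> (h x, h y) \<in> map_prod h h ` (R - {(u, v0)})"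
        if "(x, y) \<in> R - {(u, v0)}" for x y
        using that out E by (intro conjI map_prod_imageI) blast+
      have eqI: "insert e {(x, y) \<in> F. (h x, h y) \<in> M} = R"
        if "\<And>x y. (x, y) \<in> F \<Longrightarrow> (h x, h y) \<in> M \<Longrightarrow> (x, y) \<in> R"
          "\<And>x y. (x, y) \<in> R - {e} \<Longrightarrow> (x, y) \<in> F \<and> (h x, h y) \<in> M" "e \<in> R" for e F M
        using that by blast
      show "insert (u, v0)
          {(x, y) \<in> ?E1. (h x, h y) \<in> map_prod h h ` (R - {(u, v0)})} = R"
        by (rule eqI[OF E1_R R_E1 uv0(1)]) (use R in simp_all)
    qed
    show "(\<lambda>S. insert (u, v0) {(x, y) \<in> ?E1. (h x, h y) \<in> S}) `
      acyclic_relations_sink (V - {u}) (contraction v0 u E) v0 \<subseteq> ?T"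
    proof clarify
      fix S assume "S \<in> acyclic_relations_sink (V - {u}) (contraction v0 u E) v0"
      then have S: "S \<union> S\<inverse> = map_prod h h ` ?E1" "acyclic S" "V - {u} - Domain S = {v0}"
        by (auto simp: acyclic_relations_sink_def contraction)
      define R where "R = {(x, y) \<in> ?E1. (h x, h y) \<in> S}"
      have R: "(x, y) \<in> R \<longleftrightarrow> (x, y) \<in> ?E1 \<and> (h x, h y) \<in> S" for x y by (simp add: R_def)
      have v0S: "(v0, y) \<notin> S" for y using S(3) by blast
      have uo: "(u, y) \<notin> R" "(v0, y) \<notin> R" for y
        using v0S assms(5) by (simp_all add: R h)
      have "(h x, h y) \<in> S\<^sup>+" if "(x, y) \<in> R\<^sup>+" for x y
        using that
      proof (induction)
        case (base y)
        then show ?case unfolding R by blast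
      next
        case (step y z)
        then show ?case unfolding R by (meson trancl_into_trancl)
      qed
      then have "acyclic R" using S(2) unfolding acyclic_def by blast
      moreover have "(v0, u) \<notin> R\<^sup>*"
        using uo(2) assms(5) by (auto elim: converse_rtranclE)
      ultimately have "acyclic (insert (u, v0) R)" by (simp add: acyclic_insert)
      moreover have "insert (u, v0) R \<union> (insert (u, v0) R)\<inverse> = E"
      proof
        show "insert (u, v0) R \<union> (insert (u, v0) R)\<inverse> \<subseteq> E"
          using assms(2,6) by (auto simp: R dest: symD)
        show "E \<subseteq> insert (u, v0) R \<union> (insert (u, v0) R)\<inverse>"
        proof
          fix e assume "e \<in> E"
          then obtain x y where xy: "e = (x, y)" "(x, y) \<in> E" by (cases e) auto
          show "e \<in> insert (u, v0) R \<union> (insert (u, v0) R)\<inverse>"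
          proof (cases "(x, y) \<in> ?E1")
            case True
            then have "(h x, h y) \<in> S \<union> S\<inverse>" unfolding S(1) by (metis map_prod_imageI)
            moreover have "(y, x) \<in> ?E1" using True assms(2) by (auto dest: symD)
            ultimately show ?thesis using True xy(1) R by blast
          next
            case False
            then show ?thesis using xy by auto
          qed
        qed
      qed
      moreover have "V - Domain (insert (u, v0) R) = {v0}"
      proof
        show "{v0} \<subseteq> V - Domain (insert (u, v0) R)" using assms(3,5) uo(2) by auto
        show "V - Domain (insert (u, v0) R) \<subseteq> {v0}"
        proof (rule subsetI, rule ccontr)
          fix x assume x: "x \<in> V - Domain (insert (u, v0) R)" "x \<notin> {v0}"
          then have "x \<in> Domain S" "x \<noteq> u" using S(3) by auto
          then obtain z where z: "(x, z) \<in> S" by blast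
          then have "(x, z) \<in> map_prod h h ` ?E1" using S(1) by blast
          then obtain a b where ab: "(a, b) \<in> ?E1" "x = h a" "z = h b"
            by (metis Pair_inject prod_fun_imageE)
          have "a = x" using x(2) ab(2) h[of a] by (cases "a = u") simp_all
          then have "(x, b) \<in> R" using ab z R[of x b] by simp
          then show False using x(1) by blast
        qed
      qed
      moreover have "insert (u, v0) R `` {u} = {v0}" using uo(1) by blast
      ultimately show "insert (u, v0) {(x, y) \<in> ?E1. (h x, h y) \<in> S} \<in> ?A \<and>
          insert (u, v0) {(x, y) \<in> ?E1. (h x, h y) \<in> S} `` {u} = {v0}"
        unfolding acyclic_relations_sink_def R_def by blast
    qed
    show "(\<lambda>R. map_prod h h ` (R - {(u, v0)})) ` ?T \<subseteq>
      acyclic_relations_sink (V - {u}) (contraction v0 u E) v0"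
    proof clarify
      fix R assume RA: "R \<in> ?A" and Ru: "R `` {u} = {v0}"
      then have R: "R \<union> R\<inverse> = E" "acyclic R" "V - Domain R = {v0}"
        by (auto simp: acyclic_relations_sink_def)
      let ?R' = "R - {(u, v0)}"
      let ?S = "map_prod h h ` ?R'"
      have out: "x \<noteq> u \<and> x \<noteq> v0" if "(x, y) \<in> ?R'" for x y
        using that uv0(2)[OF RA] Ru by blast
      have S: "(a, b) \<in> ?S \<longleftrightarrow> (\<exists>y. (a, y) \<in> ?R' \<and> b = h y)" for a b
        using out by (force simp: h)
      \<comment> \<open>a path in the contraction lifts to \<open>R\<close> as long as it does not end in the merged point\<close>
      have path: "b = v0 \<or> (a, b) \<in> R\<^sup>+" if "(a, b) \<in> ?S\<^sup>+" for a b
        using that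
      proof (induction)
        case (base b)
        then obtain y where "(a, y) \<in> ?R'" "b = h y" unfolding S by auto
        then show ?case by (auto simp: h)
      next
        case (step b c)
        then obtain y where "(b, y) \<in> ?R'" "c = h y" unfolding S by auto
        moreover from this have "(a, b) \<in> R\<^sup>+" using out step.IH by blast
        ultimately show ?case by (auto simp: h intro: trancl_into_trancl)
      qed
      have "acyclic ?S"
        unfolding acyclic_def
      proof clarify
        fix x assume x: "(x, x) \<in> ?S\<^sup>+"
        then obtain y where "(x, y) \<in> ?S" by (meson tranclD)
        then have "x \<noteq> v0" unfolding S using out by blast
        then show False using path[OF x] R(2) by (auto simp: acyclic_def)
      qed
      moreover have "?S \<union> ?S\<inverse> = contraction v0 u E"
      proof -
        have union: "?R' \<union> ?R'\<inverse> = ?E1" using R(1) uv0[OF RA] by blast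
        have converse: "(map_prod h h ` X)\<inverse> = map_prod h h ` (X\<inverse>)" for X
        proof (intro set_eqI iffI)
          fix e assume "e \<in> (map_prod h h ` X)\<inverse>"
          then obtain x y where "e = (h y, h x)" "(x, y) \<in> X" by blast
          then show "e \<in> map_prod h h ` (X\<inverse>)" by (metis converse_iff map_prod_imageI)
        next
          fix e assume "e \<in> map_prod h h ` (X\<inverse>)"
          then obtain x y where "e = (h y, h x)" "(x, y) \<in> X" by blast
          then show "e \<in> (map_prod h h ` X)\<inverse>" by (metis converse_iff map_prod_imageI)
        qed
        show ?thesis unfolding contraction union[symmetric] image_Un converse ..
      qed
      moreover have "V - {u} - Domain ?S = {v0}"
      proof -
        have "x \<in> Domain ?S \<longleftrightarrow> x \<in> Domain ?R'" for x
          unfolding Domain_iff S by blast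
        then have "Domain ?S = Domain ?R'" by (rule set_eqI)
        moreover have "Domain ?R' = Domain R - {u}"
        proof (intro equalityI subsetI)
          fix x assume "x \<in> Domain ?R'"
          then obtain y where "(x, y) \<in> ?R'" by blast
          then show "x \<in> Domain R - {u}" using out[of x y] by blast
        next
          fix x assume "x \<in> Domain R - {u}"
          then show "x \<in> Domain ?R'" by blast
        qed
        moreover have "V - {u} - (D - {u}) = {v0}" if "V - D = {v0}" for D
          using that assms(5) by blast
        ultimately show ?thesis using R(3) by (simp only:)
      qed
      ultimately show "?S \<in> acyclic_relations_sink (V - {u}) (contraction v0 u E) v0"
        by (simp add: acyclic_relations_sink_def)
    qed
  qed
  show ?thesis
    unfolding split bij_betw_same_card[OF delete] bij_betw_same_card[OF contract] ..
qed

section \<open>The linear coefficient of the chromatic polynomial\<close>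

text \<open>
  These properties let the induction on the number of points and edges continue with the contraction.
\<close>

lemma contraction_properties:
  assumes "finite E" "E \<subseteq> V \<times> V" "sym E" "v0 \<in> V" "u \<noteq> v0" "(u, v0) \<in> E"
  shows "contraction v0 u E \<subseteq> (V - {u}) \<times> (V - {u})"
    and "sym (contraction v0 u E)"
    and "card (contraction v0 u E) < card E"
proof -
  define h where "h = id(u := v0)"
  have h: "h x = (if x = u then v0 else x)" for x by (simp add: h_def)
  define E1 where "E1 = E - {(u, v0), (v0, u)}"
  have contraction: "contraction v0 u E = map_prod h h ` E1"
    by (simp add: contraction_def h_def E1_def)
  have E1: "E1 \<subseteq> V \<times> V" "sym E1"
    using assms(2,3) by (auto simp: E1_def sym_def)
  have hV: "h x \<in> V - {u}" if "x \<in> V" for x using that assms(4,5) by (simp add: h)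
  show "contraction v0 u E \<subseteq> (V - {u}) \<times> (V - {u})"
  proof
    fix e assume "e \<in> contraction v0 u E"
    then obtain x y where "e = (h x, h y)" "(x, y) \<in> E1" unfolding contraction by blast
    moreover from this have "x \<in> V" "y \<in> V" using E1(1) by blast+
    ultimately show "e \<in> (V - {u}) \<times> (V - {u})" using hV by blast
  qed
  show "sym (contraction v0 u E)"
  proof (rule symI)
    fix a b assume "(a, b) \<in> contraction v0 u E"
    then obtain x y where "a = h x" "b = h y" "(x, y) \<in> E1" unfolding contraction by blast
    then show "(b, a) \<in> contraction v0 u E"
      using symD[OF E1(2)] unfolding contraction by (metis map_prod_imageI)
  qed
  have "card (contraction v0 u E) \<le> card E1"
    unfolding contraction using assms(1) by (intro card_image_le) (simp add: E1_def)
  also have "card E1 < card E"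
    using assms(1,6) by (intro psubset_card_mono) (auto simp: E1_def)
  finally show "card (contraction v0 u E) < card E" .
qed

text \<open>
  The color of the isolated point \<open>v0\<close> can be chosen freely.
\<close>

lemma card_relation_colorings_isolated:
  assumes "v0 \<notin> V" "E \<subseteq> V \<times> V"
  shows "card (relation_colorings (insert v0 V) E n) = n * card (relation_colorings V E n)"
proof -
  let ?extend = "\<lambda>(y, g). g(v0 := y :: nat)"
  have proper: "(\<forall>(x, y)\<in>E. (g(v0 := c)) x \<noteq> (g(v0 := c)) y) \<longleftrightarrow> (\<forall>(x, y)\<in>E. g x \<noteq> g y)"
    for g :: "'a \<Rightarrow> nat" and c
  proof (intro ball_cong refl)
    fix e assume "e \<in> E"
    then have "fst e \<noteq> v0" "snd e \<noteq> v0" using assms by auto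
    then show "(case e of (x, y) \<Rightarrow> (g(v0 := c)) x \<noteq> (g(v0 := c)) y) \<longleftrightarrow>
        (case e of (x, y) \<Rightarrow> g x \<noteq> g y)" by (simp add: case_prod_beta)
  qed
  have "relation_colorings (insert v0 V) E n = ?extend ` ({1..n} \<times> relation_colorings V E n)"
  proof -
    have "{\<kappa> \<in> f ` (A \<times> B). P \<kappa>} = f ` (A \<times> {g \<in> B. P g})"
      if "\<And>y g. P (f (y, g)) \<longleftrightarrow> P g" for A B P and f :: "nat \<times> ('a \<Rightarrow> nat) \<Rightarrow> 'a \<Rightarrow> nat"
      using that by auto
    then show ?thesis unfolding relation_colorings_def PiE_insert_eq by (simp only: proper prod.case)
  qed
  moreover have "inj_on ?extend ({1..n} \<times> relation_colorings V E n)"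
    by (rule inj_on_subset[OF inj_combinator[OF assms(1), where T = "\<lambda>_. {1..n}"]])
      (auto simp: relation_colorings_def)
  ultimately show ?thesis by (simp add: card_image card_cartesian_product)
qed

text \<open>
  A finite acyclic relation has a maximal point in \<open>V\<close>, and this is a sink different from \<open>v0\<close>,
  because no arc leads from \<open>V\<close> to \<open>v0\<close>.
\<close>

lemma acyclic_relations_sink_isolated:
  assumes "finite V" "E \<subseteq> V \<times> V" "v0 \<notin> V" "v1 \<in> V"
  shows "acyclic_relations_sink (insert v0 V) E v0 = {}"
proof (rule ccontr)
  assume "acyclic_relations_sink (insert v0 V) E v0 \<noteq> {}"
  then obtain R where R: "R \<union> R\<inverse> = E" "acyclic R" "insert v0 V - Domain R = {v0}"
    by (auto simp: acyclic_relations_sink_def)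
  have "finite R" using R(1) assms(1,2) by (metis finite_SigmaI finite_Un finite_subset)
  then have "wf (R\<inverse>)" using R(2) by (rule finite_acyclic_wf_converse)
  then obtain z where z: "z \<in> V" "\<And>y. (y, z) \<in> R\<inverse> \<Longrightarrow> y \<notin> V"
    using assms(4) by (metis wfE_min)
  have "z \<notin> insert v0 V - Domain R" unfolding R(3) using z(1) assms(3) by blast
  then have "z \<in> Domain R" using z(1) by blast
  then obtain y where "(z, y) \<in> R" by blast
  then show False using z(2) R(1) assms(2) by blast
qed

text \<open>
  The theorem of Greene and Zaslavsky, by induction on the number of points and edges. A loop makes
  both sides zero, and an edge at \<open>v0\<close> is deleted and contracted; the sign changes because the
  contraction has one point less. If \<open>v0\<close> is isolated and there are other points, both sides are zero
  again: there is no orientation with the single sink \<open>v0\<close>, and the chromatic polynomial is \<open>n\<close> times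
  that of the other points, whose constant coefficient vanishes. For this step the constant
  coefficient is part of the claim.
\<close>

lemma chromatic_polynomial_linear_coeff:
  assumes "finite V" "E \<subseteq> V \<times> V" "sym E" "v0 \<in> V"
  shows "\<exists>p :: complex poly. (\<forall>n. poly p (of_nat n) = of_nat (card (relation_colorings V E n))) \<and>
    coeff p 0 = 0 \<and>
    of_nat (card (acyclic_relations_sink V E v0)) = (- 1) ^ (card V - 1) * coeff p 1"
  using assms
proof (induction "card V + card E" arbitrary: V E v0 rule: less_induct)
  case (less V E v0)
  have finE: "finite E" using less.prems(1,2) by (meson finite_SigmaI finite_subset)
  show ?case
  proof (cases "irrefl E")
    case False
    then obtain x where x: "(x, x) \<in> E" by (auto simp: irrefl_def)
    then have "relation_colorings V E n = {}" for n
      by (auto simp: relation_colorings_def)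
    moreover have "acyclic_relations_sink V E v0 = {}"
      using x by (auto simp: acyclic_relations_sink_def acyclic_def)
    ultimately show ?thesis by (intro exI[of _ 0]) simp
  next
    case irrefl: True
    show ?thesis
    proof (cases "\<exists>u. (u, v0) \<in> E")
      case True
      then obtain u where u: "(u, v0) \<in> E" by blast
      then have uv: "u \<noteq> v0" "u \<in> V" using irrefl less.prems(2) by (auto simp: irrefl_def)
      let ?E1 = "E - {(u, v0), (v0, u)}" and ?E2 = "contraction v0 u E"
      note facts = contraction_properties[OF finE less.prems(2-4) uv(1) u]
      have "card ?E1 < card E" using finE u by (intro psubset_card_mono) auto
      then have lt: "card V + card ?E1 < card V + card E" by simp
      have E1: "?E1 \<subseteq> V \<times> V" "sym ?E1" using less.prems(2,3) by (auto simp: sym_def)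
      from less.hyps[OF lt less.prems(1) E1 less.prems(4)] obtain p1 :: "complex poly" where
        p1: "\<And>n. poly p1 (of_nat n) = of_nat (card (relation_colorings V ?E1 n))" "coeff p1 0 = 0"
          "of_nat (card (acyclic_relations_sink V ?E1 v0)) = (- 1) ^ (card V - 1) * coeff p1 1"
        by blast
      have card: "card (V - {u}) = card V - 1" "card V - 1 = Suc (card V - 1 - 1)"
      proof -
        show "card (V - {u}) = card V - 1" using uv(2) less.prems(1) by simp
        have "card {u, v0} \<le> card V" using uv less.prems(1,4) by (intro card_mono) auto
        then show "card V - 1 = Suc (card V - 1 - 1)" using uv(1) by simp
      qed
      have lt: "card (V - {u}) + card ?E2 < card V + card E" using facts(3) card(1) by simp
      have V: "finite (V - {u})" "v0 \<in> V - {u}" using less.prems(1,4) uv by auto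
      from less.hyps[OF lt V(1) facts(1,2) V(2)] obtain p2 :: "complex poly" where
        p2: "\<And>n. poly p2 (of_nat n) = of_nat (card (relation_colorings (V - {u}) ?E2 n))"
          "coeff p2 0 = 0"
          "of_nat (card (acyclic_relations_sink (V - {u}) ?E2 v0)) =
            (- 1) ^ (card (V - {u}) - 1) * coeff p2 1"
        by blast
      show ?thesis
      proof (intro exI[of _ "p1 - p2"] conjI allI)
        fix n
        show "poly (p1 - p2) (of_nat n) = of_nat (card (relation_colorings V E n))"
          using card_relation_colorings_deletion_contraction
            [OF less.prems(1,4) uv(2,1) less.prems(2) u, of n]
          by (simp add: p1 p2)
        show "coeff (p1 - p2) 0 = 0" by (simp add: p1 p2)
        have "of_nat (card (acyclic_relations_sink V E v0)) =
            (- 1) ^ (card V - 1) * coeff p1 1 + (- 1) ^ (card V - 1 - 1) * coeff p2 1"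
          unfolding card_acyclic_relations_sink_deletion_contraction
            [OF finE less.prems(3,4) uv(2,1) u]
          by (simp only: of_nat_add p1(3) p2(3) card(1))
        also have "(- 1 :: complex) ^ (card V - 1 - 1) = - ((- 1) ^ (card V - 1))"
          by (subst (2) card(2)) simp
        finally show "of_nat (card (acyclic_relations_sink V E v0)) =
            (- 1) ^ (card V - 1) * coeff (p1 - p2) 1"
          by (simp add: algebra_simps)
      qed
    next
      case False
      define V' where "V' = V - {v0}"
      have V': "V = insert v0 V'" "v0 \<notin> V'" "finite V'"
        using less.prems(1,4) by (auto simp: V'_def)
      have E: "E \<subseteq> V' \<times> V'"
        using False less.prems(2,3) by (auto simp: V'_def dest: symD)
      show ?thesis
      proof (cases "V' = {}")
        case True
        then have "E = {}" "V = {v0}" using E V'(1) by auto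
        then have "acyclic_relations_sink V E v0 = {{}}"
          by (auto simp: acyclic_relations_sink_def acyclic_def)
        moreover have "card (relation_colorings V E n) = n" for n
          using card_relation_colorings_isolated[OF V'(2) E, of n] V'(1) True \<open>E = {}\<close>
          by (simp add: relation_colorings_def)
        ultimately show ?thesis using \<open>V = {v0}\<close> by (intro exI[of _ "[:0, 1:]"]) simp
      next
        case False
        then obtain v1 where v1: "v1 \<in> V'" by blast
        have lt: "card V' + card E < card V + card E" using V' by simp
        from less.hyps[OF lt V'(3) E less.prems(3) v1] obtain q :: "complex poly" where
          q: "\<And>n. poly q (of_nat n) = of_nat (card (relation_colorings V' E n))" "coeff q 0 = 0"
          by blast
        have "card (relation_colorings V E n) = n * card (relation_colorings V' E n)" for n
          unfolding V'(1) by (rule card_relation_colorings_isolated[OF V'(2) E])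
        moreover have "acyclic_relations_sink V E v0 = {}"
          unfolding V'(1) using V'(3) E V'(2) v1 by (rule acyclic_relations_sink_isolated)
        ultimately show ?thesis using q by (intro exI[of _ "[:0, 1:] * q"]) simp
      qed
    qed
  qed
qed

section \<open>From orientations of a multigraph to acyclic relations\<close>

definition adjacency :: "('v, 'e) multigraph \<Rightarrow> 'v rel" where
  "adjacency G = {(x, y). \<exists>a\<in>edges G. ends G a = Upair x y}"

lemma acyclic_digraph_iff:
  assumes "wf_digraph D"
  shows "acyclic_digraph D \<longleftrightarrow> acyclic (arcs_ends D)"
proof -
  interpret wf_digraph D by fact
  have "(\<exists>p. cycle p) \<longleftrightarrow> (\<exists>u. (u, u) \<in> (arcs_ends D)\<^sup>+)"
  proof
    assume "\<exists>p. cycle p"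
    then show "\<exists>u. (u, u) \<in> (arcs_ends D)\<^sup>+" unfolding cycle_def reachable1_awalk by blast
  next
    assume "\<exists>u. (u, u) \<in> (arcs_ends D)\<^sup>+"
    then obtain p where "closed_w p" unfolding closed_w_def reachable1_awalk by auto
    then show "\<exists>p. cycle p" by (rule closed_w_imp_cycle)
  qed
  then show ?thesis by (auto simp: acyclic_digraph_def acyclic_def)
qed

lemma wf_digraph_orientation:
  assumes "finite_multigraph G" "D \<in> orientations G"
  shows "wf_digraph D"
proof
  fix a assume "a \<in> arcs D"
  then have "{tail D a, head D a} = set_uprod (ends G a)" "a \<in> edges G"
    using assms(2) by (auto simp: orientations_def simp flip: set_uprod_simps)
  then have "{tail D a, head D a} \<subseteq> verts D"
    using assms by (simp add: finite_multigraph_def orientations_def)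
  then show "tail D a \<in> verts D" "head D a \<in> verts D" by auto
qed

text \<open>
  In an acyclic orientation two parallel edges cannot have opposite directions. Therefore the
  direction of each edge, and with it the orientation, can be recovered from the relation of its arcs.
  With a loop both sets are empty.
\<close>

lemma bij_betw_arcs_ends:
  assumes "finite_multigraph G"
  shows "bij_betw arcs_ends (acyclic_orientations_sink G v0)
    (acyclic_relations_sink (nodes G) (adjacency G) v0)"
proof (rule bij_betw_imageI)
  have acyclic: "acyclic (arcs_ends D)"
    if "D \<in> acyclic_orientations_sink G v0" for D
    using that wf_digraph_orientation[OF assms] acyclic_digraph_iff
    by (auto simp: acyclic_orientations_sink_def)
  have arcs_ends_mem: "(tail D a, head D a) \<in> arcs_ends D" if "a \<in> arcs D"
    for a and D :: "('a, 'b) pre_digraph"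
    unfolding arcs_ends_conv using that by (rule imageI)
  have swap: False if "acyclic R" "(x, y) \<in> R" "(y, x) \<in> R" for R and x y :: 'a
    using that unfolding acyclic_def by (meson r_into_trancl trancl_into_trancl)
  have sinks: "{u. is_sink D u} = nodes G - Domain (arcs_ends D)"
    if "D \<in> orientations G" "acyclic (arcs_ends D)" for D
  proof -
    have "tail D a \<noteq> head D a" if a: "a \<in> arcs D" for a
    proof -
      have "(tail D a, head D a) \<in> arcs_ends D" using a by (rule arcs_ends_mem)
      then show ?thesis using swap[OF \<open>acyclic (arcs_ends D)\<close>] by metis
    qed
    then have "is_sink D u \<longleftrightarrow> u \<in> verts D \<and> u \<notin> Domain (arcs_ends D)" for u
      unfolding is_sink_def arcs_ends_conv by (auto simp: Domain_iff) force
    then show ?thesis using \<open>D \<in> orientations G\<close> by (auto simp: orientations_def)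
  qed
  have adjacency: "arcs_ends D \<union> (arcs_ends D)\<inverse> = adjacency G" if D: "D \<in> orientations G" for D
  proof -
    have "(x, y) \<in> arcs_ends D \<union> (arcs_ends D)\<inverse> \<longleftrightarrow>
        (\<exists>a\<in>arcs D. Upair (tail D a) (head D a) = Upair x y)" for x y
      unfolding arcs_ends_conv by (auto simp: image_iff)
    moreover have "(\<exists>a\<in>arcs D. Upair (tail D a) (head D a) = Upair x y) \<longleftrightarrow>
        (x, y) \<in> adjacency G" for x y
      using D unfolding adjacency_def orientations_def by (simp del: Upair_inject)
    ultimately show ?thesis by auto
  qed
  show "inj_on arcs_ends (acyclic_orientations_sink G v0)"
  proof (rule inj_onI)
    fix D D' assume D: "D \<in> acyclic_orientations_sink G v0"
      and D': "D' \<in> acyclic_orientations_sink G v0" and eq: "arcs_ends D = arcs_ends D'"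
    have or: "D \<in> orientations G" "D' \<in> orientations G"
      using D D' by (auto simp: acyclic_orientations_sink_def)
    have "tail D a = tail D' a \<and> head D a = head D' a" if a: "a \<in> edges G" for a
    proof -
      have "Upair (tail D a) (head D a) = Upair (tail D' a) (head D' a)"
        using or a by (simp add: orientations_def)
      moreover have "a \<in> arcs D" "a \<in> arcs D'" using or a by (auto simp: orientations_def)
      then have "(tail D a, head D a) \<in> arcs_ends D" "(tail D' a, head D' a) \<in> arcs_ends D"
        using arcs_ends_mem[of a D] arcs_ends_mem[of a D'] eq by auto
      ultimately show ?thesis using swap[OF acyclic[OF D]] by (metis Upair_inject)
    qed
    then have "tail D = tail D'" "head D = head D'"
      using or by (auto intro!: extensionalityI[of _ "edges G"] simp: orientations_def)
    then show "D = D'" using or by (auto simp: orientations_def)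
  qed
  show "arcs_ends ` acyclic_orientations_sink G v0 =
    acyclic_relations_sink (nodes G) (adjacency G) v0"
  proof (intro equalityI subsetI)
    fix R assume "R \<in> arcs_ends ` acyclic_orientations_sink G v0"
    then obtain D where D: "D \<in> acyclic_orientations_sink G v0" "R = arcs_ends D" by blast
    then have "D \<in> orientations G" "{u. is_sink D u} = {v0}"
      by (auto simp: acyclic_orientations_sink_def)
    then show "R \<in> acyclic_relations_sink (nodes G) (adjacency G) v0"
      using adjacency sinks acyclic[OF D(1)] D(2) by (simp add: acyclic_relations_sink_def)
  next
    fix R assume "R \<in> acyclic_relations_sink (nodes G) (adjacency G) v0"
    then have R: "R \<union> R\<inverse> = adjacency G" "acyclic R" "nodes G - Domain R = {v0}"
      by (auto simp: acyclic_relations_sink_def)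
    have "\<exists>e. e \<in> R \<and> Upair (fst e) (snd e) = ends G a" if a: "a \<in> edges G" for a
    proof -
      obtain x y where xy: "ends G a = Upair x y" by (cases "ends G a")
      then have "(x, y) \<in> R \<union> R\<inverse>" using a R(1) by (auto simp: adjacency_def)
      then show ?thesis using xy by (metis UnE Upair_inject converse_iff fst_conv snd_conv)
    qed
    then obtain f where f: "\<And>a. a \<in> edges G \<Longrightarrow> f a \<in> R"
      "\<And>a. a \<in> edges G \<Longrightarrow> Upair (fst (f a)) (snd (f a)) = ends G a" by metis
    \<comment> \<open>the restrictions make tail and head extensional, as for every orientation of \<open>G\<close>\<close>
    define D where "D = \<lparr>verts = nodes G, arcs = edges G,
      tail = restrict (fst \<circ> f) (edges G), head = restrict (snd \<circ> f) (edges G)\<rparr>"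
    have D: "D \<in> orientations G" using f(2) by (simp add: D_def orientations_def)
    have "arcs_ends D = f ` edges G"
      by (auto simp: arcs_ends_conv D_def)
    moreover have "R \<subseteq> f ` edges G"
    proof
      fix e assume e: "e \<in> R"
      obtain x y where xy: "e = (x, y)" by (cases e)
      then have "(x, y) \<in> adjacency G" using e R(1) by blast
      then obtain a where a: "a \<in> edges G" "ends G a = Upair x y"
        by (auto simp: adjacency_def)
      then have "f a = (x, y) \<or> f a = (y, x)" using f(2)[OF a(1)] by (cases "f a") auto
      then have "f a = e" using swap[OF R(2), of x y] f(1)[OF a(1)] e xy by auto
      then show "e \<in> f ` edges G" using a(1) by blast
    qed
    ultimately have DR: "arcs_ends D = R" using f(1) by auto
    then have "D \<in> acyclic_orientations_sink G v0"
      using D R sinks[OF D] acyclic_digraph_iff[OF wf_digraph_orientation[OF assms D]]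
      by (simp add: acyclic_orientations_sink_def)
    then show "R \<in> arcs_ends ` acyclic_orientations_sink G v0" using DR by blast
  qed
qed

section \<open>Falling factorials\<close>

definition falling_poly :: "nat \<Rightarrow> complex poly" where
  "falling_poly k = (\<Prod>i<k. [:- of_nat i, 1:])"

text \<open>
  The truncated subtraction is harmless: if \<open>n < k\<close>, the factor with \<open>i = n\<close> is zero on both sides.
\<close>

lemma poly_falling_poly:
  "poly (falling_poly k) (of_nat n) = of_nat (\<Prod>i<k. n - i)"
proof (cases "k \<le> n")
  case True
  then show ?thesis
    unfolding falling_poly_def poly_prod of_nat_prod by (intro prod.cong) (auto simp: of_nat_diff)
next
  case False
  then have "n \<in> {..<k}" by simp
  then have "(\<Prod>i<k. n - i) = 0" "(\<Prod>i<k. poly [:- of_nat i, 1:] (of_nat n :: complex)) = 0"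
    by (auto intro!: prod_zero bexI[of _ n])
  then show ?thesis unfolding falling_poly_def poly_prod by (simp only: of_nat_0)
qed

lemma falling_poly_Suc:
  "falling_poly (Suc k) = [:0, 1:] * (\<Prod>i<k. [:- of_nat (Suc i), 1:])"
  unfolding falling_poly_def prod.lessThan_Suc_shift by simp

lemma coeff_falling_poly_1:
  "coeff (falling_poly (Suc k)) 1 = (- 1) ^ k * fact k"
proof -
  have "coeff (falling_poly (Suc k)) 1 = poly (\<Prod>i<k. [:- of_nat (Suc i), 1:]) 0"
    unfolding falling_poly_Suc by (simp add: poly_0_coeff_0)
  also have "\<dots> = (\<Prod>i<k. (- 1) * of_nat (Suc i))"
    unfolding poly_prod by (intro prod.cong) auto
  also have "\<dots> = (- 1) ^ k * fact k"
    by (simp only: prod.distrib fact_prod_Suc atLeast0LessThan prod_constant card_lessThan of_nat_prod)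
  finally show ?thesis .
qed

text \<open>
  With two different blocks, the product is divisible by the square of the indeterminate.
\<close>

lemma coeff_prod_falling_poly_1:
  assumes "finite P" "\<And>B. B \<in> P \<Longrightarrow> card B > 0" "B0 \<in> P" "B1 \<in> P" "B0 \<noteq> B1"
  shows "coeff (\<Prod>B\<in>P. falling_poly (card B)) 1 = 0"
proof -
  have dvd: "[:0, 1:] dvd falling_poly (card B)" if B: "B \<in> P" for B
  proof -
    obtain k where "card B = Suc k" using assms(2)[OF B] by (cases "card B") auto
    then show ?thesis by (simp only: falling_poly_Suc dvd_triv_left)
  qed
  have "(\<Prod>B\<in>{B0, B1}. [:0, 1 :: complex:]) dvd (\<Prod>B\<in>P. falling_poly (card B))"
    using assms dvd by (intro prod_dvd_prod_subset2) auto
  then obtain q where "(\<Prod>B\<in>P. falling_poly (card B)) = [:0, 1:] * [:0, 1:] * q"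
    using assms(5) by (auto elim: dvdE)
  then show ?thesis by (simp add: coeff_pCons)
qed

text \<open>
  The blocks are disjoint, so the map can be chosen on each block independently.
\<close>

lemma card_blockwise_injective:
  assumes "finite P" "disjoint P" "\<And>B. B \<in> P \<Longrightarrow> finite B" "finite C"
  shows "card {f \<in> \<Union>P \<rightarrow>\<^sub>E C. \<forall>B\<in>P. inj_on f B} = (\<Prod>B\<in>P. \<Prod>i<card B. card C - i)"
  using assms(1-3)
proof (induction P)
  case empty
  then show ?case by simp
next
  case (insert B P)
  let ?I = "\<lambda>P. {f \<in> \<Union>P \<rightarrow>\<^sub>E C. \<forall>B\<in>P. inj_on f B}"
  let ?J = "{f \<in> B \<rightarrow>\<^sub>E C. inj_on f B}"
  have disj: "B \<inter> \<Union>P = {}"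
  proof -
    have "B \<inter> D = {}" if "D \<in> P" for D
      using that insert.hyps(2) by (intro disjointD[OF insert.prems(1)]) auto
    then show ?thesis by blast
  qed
  then have notB: "x \<notin> B" if "D \<in> P" "x \<in> D" for x D using that by blast
  have "bij_betw (\<lambda>f. (restrict f B, restrict f (\<Union>P))) (?I (insert B P)) (?J \<times> ?I P)"
  proof (rule bij_betw_byWitness[where f' = "\<lambda>(f, g) x. if x \<in> B then f x else g x"])
    show "\<forall>f\<in>?I (insert B P). (case (restrict f B, restrict f (\<Union>P)) of
        (f, g) \<Rightarrow> \<lambda>x. if x \<in> B then f x else g x) = f"
      by (auto simp: fun_eq_iff PiE_def extensional_def)
    show "\<forall>fg\<in>?J \<times> ?I P. (restrict (case fg of (f, g) \<Rightarrow> \<lambda>x. if x \<in> B then f x else g x) B,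
        restrict (case fg of (f, g) \<Rightarrow> \<lambda>x. if x \<in> B then f x else g x) (\<Union>P)) = fg"
      using notB by (force simp: fun_eq_iff PiE_def extensional_def)
    show "(\<lambda>f. (restrict f B, restrict f (\<Union>P))) ` ?I (insert B P) \<subseteq> ?J \<times> ?I P"
    proof (rule image_subsetI)
      fix f assume "f \<in> ?I (insert B P)"
      then have f: "f \<in> \<Union>(insert B P) \<rightarrow>\<^sub>E C" "\<forall>D\<in>insert B P. inj_on f D" by auto
      have "inj_on (restrict f (\<Union>P)) D" if "D \<in> P" for D
        using f(2) that by (subst inj_on_cong[of D _ f]) auto
      then show "(restrict f B, restrict f (\<Union>P)) \<in> ?J \<times> ?I P"
        using f by (auto simp: PiE_iff)
    qed
    show "(\<lambda>(f, g) x. if x \<in> B then f x else g x) ` (?J \<times> ?I P) \<subseteq> ?I (insert B P)"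
    proof clarify
      fix f g assume f: "f \<in> B \<rightarrow>\<^sub>E C" "inj_on f B"
        and g: "g \<in> \<Union>P \<rightarrow>\<^sub>E C" "\<forall>D\<in>P. inj_on g D"
      let ?fg = "\<lambda>x. if x \<in> B then f x else g x"
      have "inj_on ?fg D" if "D \<in> P" for D
        using g(2) that notB[OF that] by (subst inj_on_cong[of D _ g]) auto
      moreover have "inj_on ?fg B" using f(2) by (subst inj_on_cong[of B _ f]) auto
      moreover have "?fg \<in> \<Union>(insert B P) \<rightarrow>\<^sub>E C"
        using f(1) g(1) by (auto simp: PiE_iff extensional_def)
      ultimately show "?fg \<in> \<Union>(insert B P) \<rightarrow>\<^sub>E C \<and> (\<forall>D\<in>insert B P. inj_on ?fg D)" by blast
    qed
  qed
  then have "card (?I (insert B P)) = card (?J \<times> ?I P)" by (rule bij_betw_same_card)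
  moreover have "card ?J = (\<Prod>i<card B. card C - i)"
    using card_inj_on_subset_funcset[of B C B] insert.prems(2) assms(4)
    by (simp add: atLeast0LessThan)
  moreover have "card (?I P) = (\<Prod>B\<in>P. \<Prod>i<card B. card C - i)"
    using insert.prems insert.IH by (simp add: pairwise_insert disjoint_def)
  ultimately show ?case using insert.hyps by (simp add: card_cartesian_product)
qed

section \<open>Specializing the elementary symmetric functions\<close>

lemma sum_monomial_sum:
  assumes "finite W" "finite {s \<in> S. word s \<in> W}"
  shows "(\<Sum>w\<in>W. monomial_sum S word w) = of_nat (card {s \<in> S. word s \<in> W})"
proof -
  have "(\<Sum>w\<in>W. card {s \<in> S. word s = w}) =
      (\<Sum>w\<in>W. sum (\<lambda>_. 1) {s \<in> {s \<in> S. word s \<in> W}. word s = w})"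
    by (intro sum.cong) (auto intro!: arg_cong[where f = card])
  also have "\<dots> = card {s \<in> S. word s \<in> W}"
    using assms by (subst sum.group) auto
  finally show ?thesis by (simp add: monomial_sum_def flip: of_nat_sum)
qed

lemma monomial_sum_Union:
  assumes "finite I" "\<And>a. a \<in> I \<Longrightarrow> finite {s \<in> S a. word s = w}"
    and "\<And>a b. a \<in> I \<Longrightarrow> b \<in> I \<Longrightarrow> a \<noteq> b \<Longrightarrow> S a \<inter> S b = {}"
  shows "monomial_sum (\<Union>a\<in>I. S a) word w = (\<Sum>a\<in>I. monomial_sum (S a) word w)"
proof -
  have "{s \<in> \<Union>a\<in>I. S a. word s = w} = (\<Union>a\<in>I. {s \<in> S a. word s = w})" by blast
  moreover have "card (\<Union>a\<in>I. {s \<in> S a. word s = w}) = (\<Sum>a\<in>I. card {s \<in> S a. word s = w})"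
    using assms by (intro card_UN_disjoint) blast+
  ultimately show ?thesis by (simp add: monomial_sum_def)
qed

lemma partition_meet_eq_bot_iff:
  assumes "partition_on {1..d} \<sigma>" "partition_on {1..d} \<pi>"
  shows "partition_meet \<sigma> \<pi> = partition_bot d \<longleftrightarrow>
    (\<forall>B\<in>\<sigma>. \<forall>C\<in>\<pi>. \<forall>x\<in>B \<inter> C. \<forall>y\<in>B \<inter> C. x = y)"
proof
  assume meet: "partition_meet \<sigma> \<pi> = partition_bot d"
  show "\<forall>B\<in>\<sigma>. \<forall>C\<in>\<pi>. \<forall>x\<in>B \<inter> C. \<forall>y\<in>B \<inter> C. x = y"
  proof (intro ballI)
    fix B C x y assume BC: "B \<in> \<sigma>" "C \<in> \<pi>" and xy: "x \<in> B \<inter> C" "y \<in> B \<inter> C"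
    define f where "f X = (if X = \<sigma> then B else C)" for X
    have "C = B" if "\<sigma> = \<pi>"
      using that BC xy(1) partition_onD2[OF assms(1)] unfolding disjoint_def by blast
    then have "f \<in> (\<Pi> P\<in>{\<sigma>, \<pi>}. P)" "\<Inter> (f ` {\<sigma>, \<pi>}) = B \<inter> C"
      using BC by (auto simp: f_def)
    then have "B \<inter> C \<in> common_refinement {\<sigma>, \<pi>}"
      using xy(1) unfolding common_refinement by blast
    then have "B \<inter> C \<in> partition_bot d" using meet by (simp add: partition_meet_def)
    then obtain z where "B \<inter> C = {z}" unfolding partition_bot_def by blast
    then show "x = y" using xy by (metis singletonD)
  qed
next
  assume *: "\<forall>B\<in>\<sigma>. \<forall>C\<in>\<pi>. \<forall>x\<in>B \<inter> C. \<forall>y\<in>B \<inter> C. x = y"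
  have part: "partition_on {1..d} (partition_meet \<sigma> \<pi>)"
    unfolding partition_meet_def using assms by (intro partition_on_common_refinement) auto
  have single: "X = {x}" if "X \<in> partition_meet \<sigma> \<pi>" "x \<in> X" for X x
  proof -
    have "X \<in> common_refinement {\<sigma>, \<pi>}" using that(1) by (simp add: partition_meet_def)
    from common_refinement_exists[OF this, of \<sigma>] common_refinement_exists[OF this, of \<pi>]
    obtain B C where "B \<in> \<sigma>" "C \<in> \<pi>" "X \<subseteq> B" "X \<subseteq> C" by blast
    then show ?thesis using * that(2) by blast
  qed
  show "partition_meet \<sigma> \<pi> = partition_bot d"
  proof
    show "partition_meet \<sigma> \<pi> \<subseteq> partition_bot d"
    proof
      fix X assume X: "X \<in> partition_meet \<sigma> \<pi>"
      then obtain x where x: "x \<in> X" using partition_onD3[OF part] by (metis ex_in_conv)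
      then have "x \<in> {1..d}" using X partition_onD1[OF part] by blast
      then show "X \<in> partition_bot d" using single[OF X x] by (simp add: partition_bot_def)
    qed
    show "partition_bot d \<subseteq> partition_meet \<sigma> \<pi>"
    proof
      fix X assume "X \<in> partition_bot d"
      then obtain x where x: "X = {x}" "x \<in> {1..d}" by (auto simp: partition_bot_def)
      then obtain Y where "Y \<in> partition_meet \<sigma> \<pi>" "x \<in> Y"
        using partition_onD1[OF part] by blast
      then show "X \<in> partition_meet \<sigma> \<pi>" using single x(1) by metis
    qed
  qed
qed

lemma map_upt_eq_iff:
  assumes "f \<in> extensional {1..d}" "g \<in> extensional {1..d}"
  shows "map f [1..<Suc d] = map g [1..<Suc d] \<longleftrightarrow> f = g"
proof
  assume "map f [1..<Suc d] = map g [1..<Suc d]"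
  then have "f x = g x" if "x \<in> {1..d}" for x
    using that by (auto simp del: upt_Suc simp: map_eq_conv)
  then show "f = g" using assms by (intro extensionalityI)
qed simp

lemma finite_set_partitions: "finite (set_partitions d)"
  unfolding set_partitions_def by (rule finitely_many_partition_on) simp

text \<open>
  The second description of \<open>e\<^sub>\<pi>\<close>. Each index sequence \<open>i\<close> occurs in \<open>m\<^sub>\<sigma>\<close> for exactly one \<open>\<sigma>\<close>, namely
  the partition into the sets on which \<open>i\<close> is constant, and this \<open>\<sigma>\<close> meets \<open>\<pi>\<close> trivially if and
  only if \<open>i\<close> is injective on the blocks of \<open>\<pi>\<close>.
\<close>

lemma nc_e_eq_monomial_sum:
  assumes "\<pi> \<in> set_partitions d"
  shows "nc_e d \<pi> =
    monomial_sum {i \<in> {1..d} \<rightarrow>\<^sub>E {1..}. \<forall>B\<in>\<pi>. inj_on i B} (\<lambda>i. map i [1..<Suc d])"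
proof
  fix w
  let ?word = "\<lambda>i::nat \<Rightarrow> nat. map i [1..<Suc d]"
  let ?M = "\<lambda>\<sigma>. {i \<in> {1..d} \<rightarrow>\<^sub>E {1::nat..}.
    \<forall>j\<in>{1..d}. \<forall>k\<in>{1..d}. i j = i k \<longleftrightarrow> (\<exists>B\<in>\<sigma>. j \<in> B \<and> k \<in> B)}"
  let ?S = "{\<sigma>. \<sigma> \<in> set_partitions d \<and> partition_meet \<sigma> \<pi> = partition_bot d}"
  have \<pi>: "partition_on {1..d} \<pi>" using assms by (simp add: set_partitions_def)
  have fin: "finite {i \<in> ?M \<sigma>. ?word i = w}" for \<sigma>
  proof (rule finite_subset)
    show "{i \<in> ?M \<sigma>. ?word i = w} \<subseteq> {THE i. i \<in> {1..d} \<rightarrow>\<^sub>E {1..} \<and> ?word i = w}"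
    proof clarify
      fix i assume i: "i \<in> {1..d} \<rightarrow>\<^sub>E {1::nat..}"
      show "i = (THE i'. i' \<in> {1..d} \<rightarrow>\<^sub>E {1..} \<and> ?word i' = ?word i)"
      proof (rule the_equality[symmetric])
        fix i' assume "i' \<in> {1..d} \<rightarrow>\<^sub>E {1::nat..} \<and> ?word i' = ?word i"
        then show "i' = i" using i map_upt_eq_iff[of i' d i] unfolding PiE_iff by blast
      qed (use i in simp)
    qed
  qed simp
  \<comment> \<open>a partition is determined by any index sequence that occurs in its monomial series\<close>
  have sub: "\<sigma> \<subseteq> \<tau>" if "\<sigma> \<in> ?S" "\<tau> \<in> ?S" "i \<in> ?M \<sigma>" "i \<in> ?M \<tau>" for i \<sigma> \<tau>
  proof
    fix B assume B: "B \<in> \<sigma>"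
    have part: "partition_on {1..d} \<sigma>" "partition_on {1..d} \<tau>"
      using that by (auto simp: set_partitions_def)
    obtain x where x: "x \<in> B" using B partition_onD3[OF part(1)] by (metis ex_in_conv)
    then have xd: "x \<in> {1..d}" using B partition_onD1[OF part(1)] by blast
    then obtain C where C: "C \<in> \<tau>" "x \<in> C" using partition_onD1[OF part(2)] by blast
    have block: "D = {y \<in> {1..d}. i x = i y}"
      if "partition_on {1..d} \<rho>" "i \<in> ?M \<rho>" "D \<in> \<rho>" "x \<in> D" for \<rho> D
    proof -
      have "y \<in> D \<longleftrightarrow> (\<exists>B\<in>\<rho>. x \<in> B \<and> y \<in> B)" for y
        using that(3,4) partition_onD2[OF that(1)] unfolding disjoint_def by blast
      moreover have "D \<subseteq> {1..d}" using that(1,3) by (auto simp: partition_on_def)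
      ultimately show ?thesis using that(2) xd by auto
    qed
    have "B = C" using block[OF part(1) that(3) B x] block[OF part(2) that(4) C] by simp
    then show "B \<in> \<tau>" using C(1) by simp
  qed
  have disj: "?M \<sigma> \<inter> ?M \<tau> = {}" if "\<sigma> \<in> ?S" "\<tau> \<in> ?S" "\<sigma> \<noteq> \<tau>" for \<sigma> \<tau>
    using sub[OF that(1,2)] sub[OF that(2,1)] that(3) by blast
  have "nc_e d \<pi> w = monomial_sum (\<Union>\<sigma>\<in>?S. ?M \<sigma>) ?word w"
    unfolding nc_e_def nc_m_def
    by (rule monomial_sum_Union[symmetric])
      (use finite_set_partitions fin disj in \<open>auto simp del: upt_Suc\<close>)
  also have "(\<Union>\<sigma>\<in>?S. ?M \<sigma>) = {i \<in> {1..d} \<rightarrow>\<^sub>E {1..}. \<forall>B\<in>\<pi>. inj_on i B}"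
  proof (intro equalityI subsetI)
    fix i assume "i \<in> (\<Union>\<sigma>\<in>?S. ?M \<sigma>)"
    then obtain \<sigma> where \<sigma>: "partition_on {1..d} \<sigma>" "partition_meet \<sigma> \<pi> = partition_bot d"
      and i: "i \<in> ?M \<sigma>" by (auto simp: set_partitions_def)
    have meet: "\<forall>B\<in>\<sigma>. \<forall>C\<in>\<pi>. \<forall>x\<in>B \<inter> C. \<forall>y\<in>B \<inter> C. x = y"
      using partition_meet_eq_bot_iff[OF \<sigma>(1) \<pi>] \<sigma>(2) by simp
    have "inj_on i C" if C: "C \<in> \<pi>" for C
    proof (rule inj_onI)
      fix x y assume xy: "x \<in> C" "y \<in> C" "i x = i y"
      then have "x \<in> {1..d}" "y \<in> {1..d}" using C partition_onD1[OF \<pi>] by blast+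
      then obtain B where "B \<in> \<sigma>" "x \<in> B" "y \<in> B" using i xy(3) by blast
      then show "x = y" using meet C xy by blast
    qed
    then show "i \<in> {i \<in> {1..d} \<rightarrow>\<^sub>E {1..}. \<forall>B\<in>\<pi>. inj_on i B}" using i by blast
  next
    fix i assume i: "i \<in> {i \<in> {1..d} \<rightarrow>\<^sub>E {1::nat..}. \<forall>B\<in>\<pi>. inj_on i B}"
    define \<sigma> where "\<sigma> = (\<lambda>j. {k \<in> {1..d}. i k = i j}) ` {1..d}"
    have \<sigma>_iff: "B \<in> \<sigma> \<longleftrightarrow> (\<exists>j\<in>{1..d}. B = {k \<in> {1..d}. i k = i j})" for B
      unfolding \<sigma>_def by blast
    have part: "partition_on {1..d} \<sigma>"
    proof (rule partition_onI)
      show "\<Union>\<sigma> = {1..d}" unfolding \<sigma>_def by blast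
    qed (auto simp: \<sigma>_iff disjnt_def)
    have "i j = i k \<longleftrightarrow> (\<exists>B\<in>\<sigma>. j \<in> B \<and> k \<in> B)" if "j \<in> {1..d}" "k \<in> {1..d}" for j k
    proof
      assume "i j = i k"
      then show "\<exists>B\<in>\<sigma>. j \<in> B \<and> k \<in> B"
        using that by (intro bexI[of _ "{l \<in> {1..d}. i l = i j}"]) (auto simp: \<sigma>_def)
    next
      assume "\<exists>B\<in>\<sigma>. j \<in> B \<and> k \<in> B"
      then show "i j = i k" unfolding \<sigma>_def by force
    qed
    then have "i \<in> ?M \<sigma>" using i by blast
    moreover have "partition_meet \<sigma> \<pi> = partition_bot d"
      unfolding partition_meet_eq_bot_iff[OF part \<pi>]
    proof (intro ballI)
      fix B C x y assume "B \<in> \<sigma>" "C \<in> \<pi>" "x \<in> B \<inter> C" "y \<in> B \<inter> C"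
      moreover from this have "i x = i y" unfolding \<sigma>_iff by force
      ultimately show "x = y" using i by (auto dest: inj_onD)
    qed
    then have "\<sigma> \<in> ?S" using part by (simp add: set_partitions_def)
    ultimately show "i \<in> (\<Union>\<sigma>\<in>?S. ?M \<sigma>)" by (rule UN_I[rotated])
  qed
  finally show "nc_e d \<pi> w =
    monomial_sum {i \<in> {1..d} \<rightarrow>\<^sub>E {1..}. \<forall>B\<in>\<pi>. inj_on i B} ?word w" .
qed

text \<open>
  Summing the coefficients over these words is the specialization of \<open>n\<close> variables to \<open>1\<close> and of the
  others to \<open>0\<close>.
\<close>

definition words :: "nat \<Rightarrow> nat \<Rightarrow> nat list set" where
  "words d n = {w. set w \<subseteq> {1..n} \<and> length w = d}"

lemma finite_words: "finite (words d n)"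
  unfolding words_def by (rule finite_lists_length_eq) simp

lemma map_upt_in_words_iff: "map f [1..<Suc d] \<in> words d n \<longleftrightarrow> f ` {1..d} \<subseteq> {1..n}"
  unfolding words_def by (auto simp del: upt_Suc)

lemma sum_words_nc_e:
  assumes "\<pi> \<in> set_partitions d"
  shows "(\<Sum>w\<in>words d n. nc_e d \<pi> w) = poly (\<Prod>B\<in>\<pi>. falling_poly (card B)) (of_nat n)"
proof -
  let ?I = "{i \<in> {1..d} \<rightarrow>\<^sub>E {1::nat..}. \<forall>B\<in>\<pi>. inj_on i B}"
  have \<pi>: "partition_on {1..d} \<pi>" using assms by (simp add: set_partitions_def)
  have "i \<in> {1..d} \<rightarrow>\<^sub>E {1..} \<and> i ` {1..d} \<subseteq> {1..n} \<longleftrightarrow> i \<in> {1..d} \<rightarrow>\<^sub>E {1..n}" for i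
    by (auto simp: PiE_iff)
  then have "{i \<in> ?I. map i [1..<Suc d] \<in> words d n} = {i \<in> {1..d} \<rightarrow>\<^sub>E {1..n}. \<forall>B\<in>\<pi>. inj_on i B}"
    unfolding map_upt_in_words_iff by blast
  moreover have "finite {i \<in> {1..d} \<rightarrow>\<^sub>E {1..n}. \<forall>B\<in>\<pi>. inj_on i B}"
    by (simp add: finite_PiE)
  ultimately have "(\<Sum>w\<in>words d n. nc_e d \<pi> w) =
      of_nat (card {i \<in> {1..d} \<rightarrow>\<^sub>E {1..n}. \<forall>B\<in>\<pi>. inj_on i B})"
    unfolding nc_e_eq_monomial_sum[OF assms] by (subst sum_monomial_sum) (simp_all add: finite_words)
  also have "\<dots> = of_nat (\<Prod>B\<in>\<pi>. \<Prod>i<card B. n - i)"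
  proof -
    have "finite \<pi>" by (rule finite_elements[OF _ \<pi>]) simp
    moreover have "finite B" if "B \<in> \<pi>" for B
      using that partition_onD1[OF \<pi>] by (metis Union_upper finite_atLeastAtMost finite_subset)
    ultimately show ?thesis
      using card_blockwise_injective[of \<pi> "{1..n}"] partition_onD1[OF \<pi>] partition_onD2[OF \<pi>]
      by (simp only: finite_atLeastAtMost card_atLeastAtMost diff_Suc_1 add_Suc_right)
  qed
  also have "\<dots> = poly (\<Prod>B\<in>\<pi>. falling_poly (card B)) (of_nat n)"
    by (simp add: poly_prod poly_falling_poly)
  finally show ?thesis .
qed

section \<open>Comparing linear coefficients\<close>

lemma sum_words_nc_chromatic:
  assumes "finite (nodes G)" "bij_betw v {1..d} (nodes G)"
  shows "(\<Sum>w\<in>words d n. nc_chromatic G d v w) =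
    of_nat (card (relation_colorings (nodes G) (adjacency G) n))"
proof -
  have image: "(\<lambda>j. \<kappa> (v j)) ` {1..d} = \<kappa> ` nodes G" for \<kappa> :: "'a \<Rightarrow> nat"
    using assms(2) by (simp add: bij_betw_def flip: image_image)
  have range: "\<kappa> \<in> nodes G \<rightarrow>\<^sub>E {1..} \<and> \<kappa> ` nodes G \<subseteq> {1..n} \<longleftrightarrow> \<kappa> \<in> nodes G \<rightarrow>\<^sub>E {1..n}"
    for \<kappa> :: "'a \<Rightarrow> nat"
    by (auto simp: PiE_iff)
  have proper: "(\<forall>a\<in>edges G. \<forall>x y. ends G a = Upair x y \<longrightarrow> \<kappa> x \<noteq> \<kappa> y) \<longleftrightarrow>
      (\<forall>(x, y)\<in>adjacency G. \<kappa> x \<noteq> \<kappa> y)" for \<kappa> :: "'a \<Rightarrow> nat"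
    unfolding adjacency_def by blast
  have "{\<kappa> \<in> proper_colorings G. map (\<lambda>j. \<kappa> (v j)) [1..<Suc d] \<in> words d n} =
      relation_colorings (nodes G) (adjacency G) n"
    unfolding map_upt_in_words_iff image proper_colorings_def relation_colorings_def
      mem_Collect_eq proper using range by blast
  then show ?thesis
    unfolding nc_chromatic_def
    using sum_monomial_sum[OF finite_words, of "proper_colorings G"
        "\<lambda>\<kappa>. map (\<lambda>j. \<kappa> (v j)) [1..<Suc d]" d n] finite_relation_colorings[OF assms(1)]
    by simp
qed

lemma poly_eqI_of_nat:
  fixes p q :: "'a :: {idom, ring_char_0} poly"
  assumes "\<And>n. poly p (of_nat n) = poly q (of_nat n)"
  shows "p = q"
proof (rule ccontr)
  assume "p \<noteq> q"
  then have "finite {x. poly (p - q) x = 0}" by (intro poly_roots_finite) simp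
  moreover have "range of_nat \<subseteq> {x. poly (p - q) x = 0}" using assms by auto
  ultimately have "finite (range (of_nat :: nat \<Rightarrow> 'a))" by (rule finite_subset[rotated])
  then show False by (simp add: finite_image_iff[OF inj_of_nat])
qed

lemma coeff_prod_falling_poly_partition:
  assumes "\<pi> \<in> set_partitions d" "d > 0"
  shows "coeff (\<Prod>B\<in>\<pi>. falling_poly (card B)) 1 =
    (if \<pi> = {{1..d}} then (- 1) ^ (d - 1) * fact (d - 1) else 0)"
proof (cases "\<pi> = {{1..d}}")
  case True
  then show ?thesis using coeff_falling_poly_1[of "d - 1"] assms(2) by simp
next
  case False
  have \<pi>: "partition_on {1..d} \<pi>" using assms(1) by (simp add: set_partitions_def)
  have "\<Union>\<pi> \<noteq> {}" unfolding partition_onD1[OF \<pi>, symmetric] using assms(2) by simp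
  then obtain B0 where B0: "B0 \<in> \<pi>" by blast
  have "\<pi> \<noteq> {B0}" using False partition_onD1[OF \<pi>] by (metis cSup_singleton)
  then obtain B1 where B1: "B1 \<in> \<pi>" "B0 \<noteq> B1" using B0 by blast
  have "card B > 0" if "B \<in> \<pi>" for B
    using that partition_onD1[OF \<pi>] partition_onD3[OF \<pi>]
    by (metis Union_upper card_gt_0_iff finite_atLeastAtMost finite_subset)
  moreover have "finite \<pi>" by (rule finite_elements[OF _ \<pi>]) simp
  ultimately show ?thesis using coeff_prod_falling_poly_1[OF _ _ B0 B1] False by simp
qed

theorem theorem3p5:
  fixes G :: "('v, 'e) multigraph"
    and d :: nat
    and v :: "nat \<Rightarrow> 'v"
    and c :: "nat set set \<Rightarrow> complex"
    and v0 :: 'v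
  assumes "finite_multigraph G"
    and "bij_betw v {1..d} (nodes G)"
    and "nc_chromatic G d v = (\<lambda>w. \<Sum>\<pi>\<in>set_partitions d. c \<pi> * nc_e d \<pi> w)"
    and "v0 \<in> nodes G"
  shows "of_nat (card (acyclic_orientations_sink G v0)) = fact (d - 1) * c {{1..d}}"
proof -
  let ?E = "adjacency G"
  have fin: "finite (nodes G)" using assms(1) by (simp add: finite_multigraph_def)
  have card: "card (nodes G) = d" using bij_betw_same_card[OF assms(2)] by simp
  then have d: "d > 0" using assms(4) fin card_gt_0_iff by blast
  have E: "?E \<subseteq> nodes G \<times> nodes G" "sym ?E"
  proof
    fix e assume "e \<in> ?E"
    then obtain a x y where "e = (x, y)" "a \<in> edges G" "ends G a = Upair x y"
      by (auto simp: adjacency_def)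
    then show "e \<in> nodes G \<times> nodes G"
      using assms(1) unfolding finite_multigraph_def by force
  next
    have "ends G a = Upair x y \<longleftrightarrow> ends G a = Upair y x" for a x y
      by (cases "ends G a") auto
    then show "sym ?E" unfolding adjacency_def sym_def by blast
  qed
  obtain p :: "complex poly" where
    p: "\<And>n. poly p (of_nat n) = of_nat (card (relation_colorings (nodes G) ?E n))"
      "of_nat (card (acyclic_relations_sink (nodes G) ?E v0)) = (- 1) ^ (d - 1) * coeff p 1"
    using chromatic_polynomial_linear_coeff[OF fin E assms(4)] unfolding card by blast
  define q where "q = (\<Sum>\<pi>\<in>set_partitions d. smult (c \<pi>) (\<Prod>B\<in>\<pi>. falling_poly (card B)))"
  have "p = q"
  proof (rule poly_eqI_of_nat)
    fix n
    have "poly p (of_nat n) = (\<Sum>w\<in>words d n. \<Sum>\<pi>\<in>set_partitions d. c \<pi> * nc_e d \<pi> w)"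
      using sum_words_nc_chromatic[OF fin assms(2)] unfolding p(1) assms(3) by simp
    also have "\<dots> = (\<Sum>\<pi>\<in>set_partitions d. c \<pi> * (\<Sum>w\<in>words d n. nc_e d \<pi> w))"
      unfolding sum_distrib_left by (rule sum.swap)
    also have "\<dots> = poly q (of_nat n)"
      by (simp add: q_def poly_sum sum_words_nc_e)
    finally show "poly p (of_nat n) = poly q (of_nat n)" .
  qed
  have "coeff q 1 = (\<Sum>\<pi>\<in>set_partitions d.
      if \<pi> = {{1..d}} then c \<pi> * ((- 1) ^ (d - 1) * fact (d - 1)) else 0)"
    unfolding q_def coeff_sum coeff_smult
  proof (intro sum.cong refl)
    fix \<pi> assume "\<pi> \<in> set_partitions d"
    note coeff = coeff_prod_falling_poly_partition[OF this d]
    show "c \<pi> * coeff (\<Prod>B\<in>\<pi>. falling_poly (card B)) 1 =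
        (if \<pi> = {{1..d}} then c \<pi> * ((- 1) ^ (d - 1) * fact (d - 1)) else 0)"
      unfolding coeff by simp
  qed
  also have "{{1..d}} \<in> set_partitions d"
    using d by (auto simp: set_partitions_def partition_on_def disjoint_def)
  then have "(\<Sum>\<pi>\<in>set_partitions d.
      if \<pi> = {{1..d}} then c \<pi> * ((- 1) ^ (d - 1) * fact (d - 1)) else 0) =
      c {{1..d}} * ((- 1) ^ (d - 1) * fact (d - 1))"
    using finite_set_partitions by simp
  finally have "coeff q 1 = c {{1..d}} * ((- 1) ^ (d - 1) * fact (d - 1))" .
  moreover have "(- 1 :: complex) ^ k * (- 1) ^ k = 1" for k
    by (simp flip: power_mult_distrib)
  ultimately have "(- 1) ^ (d - 1) * coeff p 1 = fact (d - 1) * c {{1..d}}"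
    unfolding \<open>p = q\<close> by (simp add: mult.left_commute mult.commute)
  then show ?thesis
    using p(2) bij_betw_same_card[OF bij_betw_arcs_ends[OF assms(1)]] by simp
qed

end
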